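(* Let $s\in(1,\infty)$. For every $\bar u\in L^s(\Omega)$, \[ \partial q_{s,0}(\bar u)=\{\eta\in L^r(\Omega) : \{\eta\neq 0\}\subset\{\bar u=0\}\}. \]
   Context: $\Omega\subset\mathbb{R}^d$ is a Lebesgue-measurable set with positive and finite Lebesgue measure; $\boldsymbol{\lambda}$ denotes Lebesgue measure. For $s\in(1,\infty)$, $r\in(1,\infty)$ is given by $\frac1s+\frac1r=1$, and $L^r(\Omega)$ is identified with the dual of $L^s(\Omega)$. For measurable $u$, $\{u\neq0\}:=\{x\in\Omega : u(x)\neq 0\}$ and $\{u=0\}:=\{x\in\Omega : u(x)=0\}$; these sets are defined up to null sets and inclusions between them are understood up to null sets. The functional $q_{s,0}\colon L^s(\Omega)\to\mathbb{R}$ is $q_{s,0}(u):=\int_\Omega |u(x)|_0\,\mathrm{d}x=\boldsymbol{\lambda}(\{u\neq 0\})$, where $|y|_0:=0$ if $y=0$ and $|y|_0:=1$ for $y\in\mathbb{R}\setminus\{0\}$. The Fréchet subdifferential of $q_{s,0}$ at $u\in L^s(\Omega)$ is \[ \widehat{\partial} q_{s,0}(u):=\Bigl\{\eta\in L^r(\Omega) : \liminf_{\Vert h\Vert_s\searrow 0}\frac{q_{s,0}(u+h)-q_{s,0}(u)-\int_\Omega\eta(x)h(x)\,\mathrm{d}x}{\Vert h\Vert_s}\ge 0\Bigr\}, \] where the lower limit is over $h\in L^s(\Omega)\setminus\{0\}$ with $\Vert h\Vert_s\to 0$. The limiting (Mordukhovich) subdifferential $\partial q_{s,0}(\bar u)$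 is the set of all $\eta\in L^r(\Omega)$ for which there exist sequences $\{u_k\}_{k\in\mathbb{N}}\subset L^s(\Omega)$ and $\{\eta_k\}_{k\in\mathbb{N}}\subset L^r(\Omega)$ such that $u_k\to\bar u$ in $L^s(\Omega)$, $q_{s,0}(u_k)\to q_{s,0}(\bar u)$, $\eta_k\rightharpoonup\eta$ weakly in $L^r(\Omega)$, and $\eta_k\in\widehat{\partial} q_{s,0}(u_k)$ for all $k\in\mathbb{N}$. *)

theory Defs
  imports "HOL-Analysis.Analysis"
begin

text \<open>Elements of the Lebesgue space over \<open>\<Omega>\<close> are represented by functions on the whole space of
  which only the values on \<open>\<Omega>\<close> matter. No quotient is taken: every notion below is invariant under
  changing functions on null sets, so a set of classes becomes a set of functions closed under
  almost-everywhere equality on \<open>\<Omega>\<close>.\<close>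

definition Lp :: "'a::euclidean_space set \<Rightarrow> real \<Rightarrow> ('a \<Rightarrow> real) set" where
  "Lp \<Omega> p = {u. u \<in> borel_measurable (lebesgue_on \<Omega>) \<and>
                  integrable (lebesgue_on \<Omega>) (\<lambda>x. \<bar>u x\<bar> powr p)}"

definition Lp_norm :: "'a::euclidean_space set \<Rightarrow> real \<Rightarrow> ('a \<Rightarrow> real) \<Rightarrow> real" where
  "Lp_norm \<Omega> p u = (\<integral>x. \<bar>u x\<bar> powr p \<partial>lebesgue_on \<Omega>) powr (1 / p)"

definition Lp_tendsto ::
  "'a::euclidean_space set \<Rightarrow> real \<Rightarrow> (nat \<Rightarrow> 'a \<Rightarrow> real) \<Rightarrow> ('a \<Rightarrow> real) \<Rightarrow> bool" where
  "Lp_tendsto \<Omega> p U u \<longleftrightarrow> (\<lambda>k. Lp_norm \<Omega> p (\<lambda>x. U k x - u x)) \<longlonglongrightarrow> 0"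

text \<open>Boundedness forces a functional to take equal values on almost everywhere equal functions, so
  these are the elements of the topological dual of the quotient space.\<close>

definition Lp_dual :: "'a::euclidean_space set \<Rightarrow> real \<Rightarrow> (('a \<Rightarrow> real) \<Rightarrow> real) set" where
  "Lp_dual \<Omega> p = {\<phi>.
     (\<forall>f\<in>Lp \<Omega> p. \<forall>g\<in>Lp \<Omega> p. \<phi> (\<lambda>x. f x + g x) = \<phi> f + \<phi> g) \<and>
     (\<forall>c. \<forall>f\<in>Lp \<Omega> p. \<phi> (\<lambda>x. c * f x) = c * \<phi> f) \<and>
     (\<exists>C. \<forall>f\<in>Lp \<Omega> p. \<bar>\<phi> f\<bar> \<le> C * Lp_norm \<Omega> p f)}"

definition Lp_weak_tendsto ::
  "'a::euclidean_space set \<Rightarrow> real \<Rightarrow> (nat \<Rightarrow> 'a \<Rightarrow> real) \<Rightarrow> ('a \<Rightarrow> real) \<Rightarrow> bool" where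
  "Lp_weak_tendsto \<Omega> p H \<eta> \<longleftrightarrow> (\<forall>\<phi>\<in>Lp_dual \<Omega> p. (\<lambda>k. \<phi> (H k)) \<longlonglongrightarrow> \<phi> \<eta>)"

definition abs0 :: "real \<Rightarrow> real" where
  "abs0 y = (if y = 0 then 0 else 1)"

definition q0 :: "'a::euclidean_space set \<Rightarrow> ('a \<Rightarrow> real) \<Rightarrow> real" where
  "q0 \<Omega> u = (\<integral>x. abs0 (u x) \<partial>lebesgue_on \<Omega>)"

lemma q0_eq_measure:
  assumes "\<Omega> \<in> sets lebesgue" "u \<in> borel_measurable (lebesgue_on \<Omega>)"
  shows "q0 \<Omega> u = measure lebesgue {x \<in> \<Omega>. u x \<noteq> 0}"
proof -
  have "{x \<in> space (lebesgue_on \<Omega>). u x \<noteq> 0} \<in> sets (lebesgue_on \<Omega>)"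
    using assms(2) by measurable
  then have A: "{x \<in> \<Omega>. u x \<noteq> 0} \<in> sets (lebesgue_on \<Omega>)"
    by simp
  have "q0 \<Omega> u = (\<integral>x. indicator {x \<in> \<Omega>. u x \<noteq> 0} x \<partial>lebesgue_on \<Omega>)"
    unfolding q0_def by (rule Bochner_Integration.integral_cong) (auto simp: abs0_def)
  also have "\<dots> = measure (lebesgue_on \<Omega>) {x \<in> \<Omega>. u x \<noteq> 0}"
    using A by (simp add: Int_absorb2 Collect_restrict)
  also have "\<dots> = measure lebesgue {x \<in> \<Omega>. u x \<noteq> 0}"
    using assms(1) by (intro measure_restrict_space) auto
  finally show ?thesis .
qed

text \<open>The filter of \<open>h \<in> L\<^sup>p(\<Omega>) \<setminus> {0}\<close> with norm tending to zero; a representative of zero is one of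
  norm zero, and is excluded by \<^term>\<open>at_right (0::real)\<close>.\<close>

definition Lp_at_0 :: "'a::euclidean_space set \<Rightarrow> real \<Rightarrow> ('a \<Rightarrow> real) filter" where
  "Lp_at_0 \<Omega> p = inf (filtercomap (Lp_norm \<Omega> p) (at_right 0)) (principal (Lp \<Omega> p))"

text \<open>In the two subdifferentials \<open>s\<close> is the exponent of the domain of the functional and \<open>r\<close> is meant
  to be the conjugate exponent.\<close>

definition frechet_subdiff_q0 ::
  "'a::euclidean_space set \<Rightarrow> real \<Rightarrow> real \<Rightarrow> ('a \<Rightarrow> real) \<Rightarrow> ('a \<Rightarrow> real) set" where
  "frechet_subdiff_q0 \<Omega> s r u = {\<eta> \<in> Lp \<Omega> r.
     Liminf (Lp_at_0 \<Omega> s)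
       (\<lambda>h. ereal ((q0 \<Omega> (\<lambda>x. u x + h x) - q0 \<Omega> u - (\<integral>x. \<eta> x * h x \<partial>lebesgue_on \<Omega>))
                     / Lp_norm \<Omega> s h)) \<ge> 0}"

definition limiting_subdiff_q0 ::
  "'a::euclidean_space set \<Rightarrow> real \<Rightarrow> real \<Rightarrow> ('a \<Rightarrow> real) \<Rightarrow> ('a \<Rightarrow> real) set" where
  "limiting_subdiff_q0 \<Omega> s r u = {\<eta> \<in> Lp \<Omega> r. \<exists>U H.
     (\<forall>k. U k \<in> Lp \<Omega> s) \<and> (\<forall>k. H k \<in> Lp \<Omega> r) \<and>
     Lp_tendsto \<Omega> s U u \<and>
     (\<lambda>k. q0 \<Omega> (U k)) \<longlonglongrightarrow> q0 \<Omega> u \<and>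
     Lp_weak_tendsto \<Omega> r H \<eta> \<and>
     (\<forall>k. H k \<in> frechet_subdiff_q0 \<Omega> s r (U k))}"

definition ae_subset :: "'a::euclidean_space set \<Rightarrow> 'a set \<Rightarrow> bool" where
  "ae_subset A B \<longleftrightarrow> A - B \<in> null_sets lebesgue"

end

theory Submission
  imports Defs
begin

text \<open>A perturbation that leaves the support of \<open>u\<close> unchanged does not change
  \<open>q0\<close>, so on {u \<noteq> 0} a Frechet subgradient competes with nothing and must
  vanish (\<open>frechet_subdiff_q0_AE_zero\<close>). This survives the limit: along a subsequence
  \<open>U k\<close> converges almost everywhere, points of {u \<noteq> 0} eventually enter the
  supports of the \<open>U k\<close>, and the weak limit vanishes there as well
  (\<open>limiting_subdiff_q0_AE_zero\<close>).

  Conversely, where \<open>u\<close> is zero, every nonzero value of \<open>h\<close> raises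
  \<open>abs0\<close> by 1, and \<open>t \<le> 1 + t powr s\<close> then absorbs a bounded
  \<open>\<eta>\<close> up to a multiple of \<open>\<bar>h\<bar> powr s\<close>, which is
  superlinearly small after integration. If \<open>u\<close> is bounded away from zero on its
  support, cancelling \<open>u\<close> is just as expensive, so such pairs give Frechet subgradients
  (\<open>bounded_in_frechet_subdiff_q0\<close>). Cutting off small values of \<open>u\<close> and
  large values of \<open>\<eta>\<close> approximates a general pair by such pairs
  (\<open>AE_zero_in_limiting_subdiff_q0\<close>).\<close>

section \<open>Power inequalities and integrability over a set of finite measure\<close>

lemma le_one_plus_powr:
  fixes t p :: real
  assumes "0 \<le> t" "1 \<le> p"
  shows "t \<le> 1 + t powr p"
proof (cases "t \<le> 1")
  case True
  then show ?thesis by (smt (verit) powr_ge_zero)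
next
  case False
  then have "t powr 1 \<le> t powr p"
    using assms by (intro powr_mono) auto
  then show ?thesis using False by simp
qed

text \<open>Replacing both entries by the larger modulus costs a factor 2 inside the power; the
  result makes \<open>Lp\<close> closed under differences for every
  \<open>p \<ge> 0\<close>.\<close>

lemma powr_abs_diff_le:
  fixes a b p :: real
  assumes "0 \<le> p"
  shows "\<bar>a - b\<bar> powr p \<le> 2 powr p * (\<bar>a\<bar> powr p + \<bar>b\<bar> powr p)"
proof -
  have "\<bar>a - b\<bar> powr p \<le> (2 * max \<bar>a\<bar> \<bar>b\<bar>) powr p"
    using assms by (intro powr_mono2) auto
  also have "\<dots> = 2 powr p * max \<bar>a\<bar> \<bar>b\<bar> powr p"
    by (simp add: powr_mult)
  also have "\<dots> \<le> 2 powr p * (\<bar>a\<bar> powr p + \<bar>b\<bar> powr p)"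
    by (intro mult_left_mono) (auto simp: max_def)
  finally show ?thesis .
qed

lemma Lp_measurable:
  "f \<in> Lp \<Omega> p \<Longrightarrow> f \<in> borel_measurable (lebesgue_on \<Omega>)"
  by (simp add: Lp_def)

lemma Lp_integrable_powr: "f \<in> Lp \<Omega> p \<Longrightarrow> integrable (lebesgue_on \<Omega>) (\<lambda>x. \<bar>f x\<bar> powr p)"
  by (simp add: Lp_def)

lemma Lp_dominated:
  assumes "f \<in> Lp \<Omega> p" "g \<in> borel_measurable (lebesgue_on \<Omega>)" "0 \<le> p"
    and "\<And>x. \<bar>g x\<bar> \<le> \<bar>f x\<bar>"
  shows "g \<in> Lp \<Omega> p"
proof -
  have "integrable (lebesgue_on \<Omega>) (\<lambda>x. \<bar>g x\<bar> powr p)"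
    using assms
    by (intro Bochner_Integration.integrable_bound[OF Lp_integrable_powr[OF assms(1)]])
       (auto intro!: powr_mono2)
  with assms(2) show ?thesis by (simp add: Lp_def)
qed

lemma Lp_diff:
  assumes f: "f \<in> Lp \<Omega> p" and g: "g \<in> Lp \<Omega> p" and "0 \<le> p"
  shows "(\<lambda>x. f x - g x) \<in> Lp \<Omega> p"
proof -
  note [measurable] = Lp_measurable[OF f] Lp_measurable[OF g]
  have "integrable (lebesgue_on \<Omega>) (\<lambda>x. 2 powr p * (\<bar>f x\<bar> powr p + \<bar>g x\<bar> powr p))"
    using Lp_integrable_powr[OF f] Lp_integrable_powr[OF g] by simp
  then have "integrable (lebesgue_on \<Omega>) (\<lambda>x. \<bar>f x - g x\<bar> powr p)"
    by (rule Bochner_Integration.integrable_bound)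
       (auto simp: powr_abs_diff_le[OF assms(3)] intro!: AE_I2)
  then show ?thesis by (simp add: Lp_def)
qed

lemma Lp_cmult:
  assumes f: "f \<in> Lp \<Omega> p"
  shows "(\<lambda>x. c * f x) \<in> Lp \<Omega> p"
  using Lp_measurable[OF f] Lp_integrable_powr[OF f] by (simp add: Lp_def abs_mult powr_mult)

lemma Lp_bounded:
  assumes "\<Omega> \<in> lmeasurable" "f \<in> borel_measurable (lebesgue_on \<Omega>)" "0 \<le> p"
    and "\<And>x. \<bar>f x\<bar> \<le> B"
  shows "f \<in> Lp \<Omega> p"
proof -
  interpret finite_measure "lebesgue_on \<Omega>"
    by (rule finite_measure_lebesgue_on) fact
  note [measurable] = assms(2)
  have "integrable (lebesgue_on \<Omega>) (\<lambda>x. \<bar>f x\<bar> powr p)"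
    using assms(3,4) by (intro integrable_const_bound[where B = "B powr p"]) (auto intro!: AE_I2 powr_mono2)
  then show ?thesis using assms(2) by (simp add: Lp_def)
qed

lemma Lp_integrable:
  assumes "\<Omega> \<in> lmeasurable" and f: "f \<in> Lp \<Omega> p" and "1 \<le> p"
  shows "integrable (lebesgue_on \<Omega>) f"
proof -
  interpret finite_measure "lebesgue_on \<Omega>"
    by (rule finite_measure_lebesgue_on) fact
  have "integrable (lebesgue_on \<Omega>) (\<lambda>x. 1 + \<bar>f x\<bar> powr p)"
    using Lp_integrable_powr[OF f] by simp
  then show ?thesis
    using Lp_measurable[OF f] le_one_plus_powr[OF _ assms(3)]
    by (elim Bochner_Integration.integrable_bound) (auto intro!: AE_I2)
qed

text \<open>Finite measure puts \<open>f\<close> in L^1, and a bounded factor preserves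
  integrability. This makes sense of all pairings below, whether the bounded factor is a test
  function or a truncated subgradient.\<close>

lemma Lp_integrable_mult_bounded:
  assumes "\<Omega> \<in> lmeasurable" and f: "f \<in> Lp \<Omega> p" and "1 \<le> p"
    and g: "g \<in> borel_measurable (lebesgue_on \<Omega>)" "\<And>x. \<bar>g x\<bar> \<le> B"
  shows "integrable (lebesgue_on \<Omega>) (\<lambda>x. f x * g x)"
proof -
  note [measurable] = Lp_measurable[OF f] g(1)
  have "integrable (lebesgue_on \<Omega>) (\<lambda>x. B * f x)"
    using Lp_integrable[OF assms(1-3)] by simp
  moreover have "norm (f x * g x) \<le> norm (B * f x)" for x
  proof -
    have "\<bar>f x\<bar> * \<bar>g x\<bar> \<le> \<bar>f x\<bar> * \<bar>B\<bar>"
      using g(2)[of x] by (intro mult_left_mono) auto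
    then show ?thesis by (simp add: abs_mult mult.commute)
  qed
  ultimately show ?thesis
    by (elim Bochner_Integration.integrable_bound) (auto intro!: AE_I2)
qed

section \<open>The norm, bounded test functionals and convergence\<close>

lemma Lp_norm_nonneg: "0 \<le> Lp_norm \<Omega> p f"
  by (simp add: Lp_norm_def)

lemma Lp_norm_powr:
  assumes "0 < p"
  shows "Lp_norm \<Omega> p f powr p = (\<integral>x. \<bar>f x\<bar> powr p \<partial>lebesgue_on \<Omega>)"
  using assms by (simp add: Lp_norm_def powr_powr)

lemma Lp_norm_cmult:
  assumes "0 < p"
  shows "Lp_norm \<Omega> p (\<lambda>x. c * f x) = \<bar>c\<bar> * Lp_norm \<Omega> p f"
  using assms by (simp add: Lp_norm_def abs_mult powr_mult powr_powr)

lemma Lp_norm_eq_0_iff: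
  assumes f: "f \<in> Lp \<Omega> p" and "0 < p"
  shows "Lp_norm \<Omega> p f = 0 \<longleftrightarrow> (AE x in lebesgue_on \<Omega>. f x = 0)"
  using integral_nonneg_eq_0_iff_AE[OF Lp_integrable_powr[OF f]] assms(2)
  by (simp add: Lp_norm_def)

text \<open>Integrating \<open>t \<le> 1 + t powr p\<close> for \<open>t = \<bar>f x\<bar> / \<parallel>f\<parallel>\<close> gives a constant that is not sharp but makes
  Hoelder's inequality unnecessary.\<close>

lemma integral_abs_le_Lp_norm:
  assumes "\<Omega> \<in> lmeasurable" and f: "f \<in> Lp \<Omega> p" and "1 \<le> p"
  shows "(\<integral>x. \<bar>f x\<bar> \<partial>lebesgue_on \<Omega>) \<le> (measure lebesgue \<Omega> + 1) * Lp_norm \<Omega> p f"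
proof (cases "Lp_norm \<Omega> p f = 0")
  case True
  then have "AE x in lebesgue_on \<Omega>. \<bar>f x\<bar> = 0"
    using Lp_norm_eq_0_iff[OF f] assms(3) by simp
  then have "(\<integral>x. \<bar>f x\<bar> \<partial>lebesgue_on \<Omega>) = 0"
    by (rule integral_eq_zero_AE)
  then show ?thesis using True by simp
next
  case False
  interpret finite_measure "lebesgue_on \<Omega>"
    by (rule finite_measure_lebesgue_on) fact
  define N where "N = Lp_norm \<Omega> p f"
  have N: "0 < N" using False Lp_norm_nonneg[of \<Omega> p f] by (simp add: N_def)
  have Np: "(\<integral>x. \<bar>f x\<bar> powr p \<partial>lebesgue_on \<Omega>) = N powr p"
    using assms(3) by (simp add: N_def Lp_norm_powr)
  have m: "measure (lebesgue_on \<Omega>) \<Omega> = measure lebesgue \<Omega>"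
    using assms(1) by (intro measure_restrict_space) auto
  have "(\<integral>x. \<bar>f x\<bar> / N \<partial>lebesgue_on \<Omega>) \<le> (\<integral>x. 1 + \<bar>f x\<bar> powr p / N powr p \<partial>lebesgue_on \<Omega>)"
  proof (rule integral_mono)
    fix x
    have "\<bar>f x\<bar> / N \<le> 1 + (\<bar>f x\<bar> / N) powr p"
      using N assms(3) by (intro le_one_plus_powr) auto
    then show "\<bar>f x\<bar> / N \<le> 1 + \<bar>f x\<bar> powr p / N powr p"
      using N by (simp add: powr_divide)
  qed (use Lp_integrable[OF assms] Lp_integrable_powr[OF f] in auto)
  also have "\<dots> = measure lebesgue \<Omega> + 1"
    using Lp_integrable_powr[OF f] N by (simp add: Np m)
  finally show ?thesis
    using N by (simp add: N_def field_simps)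
qed

text \<open>Continuity comes from the bound of the L^1 norm by the L^p norm. These functionals are
  the ones against which weak convergence is tested.\<close>

lemma integral_mult_bounded_in_Lp_dual:
  assumes "\<Omega> \<in> lmeasurable" and "1 \<le> p"
    and g: "g \<in> borel_measurable (lebesgue_on \<Omega>)" "\<And>x. \<bar>g x\<bar> \<le> B"
  shows "(\<lambda>f. \<integral>x. f x * g x \<partial>lebesgue_on \<Omega>) \<in> Lp_dual \<Omega> p"
proof -
  have int: "integrable (lebesgue_on \<Omega>) (\<lambda>x. f x * g x)" if "f \<in> Lp \<Omega> p" for f
    using assms that by (intro Lp_integrable_mult_bounded)
  have bound: "\<bar>\<integral>x. f x * g x \<partial>lebesgue_on \<Omega>\<bar> \<le> (\<bar>B\<bar> * (measure lebesgue \<Omega> + 1)) * Lp_norm \<Omega> p f"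
    if f: "f \<in> Lp \<Omega> p" for f
  proof -
    have "\<bar>\<integral>x. f x * g x \<partial>lebesgue_on \<Omega>\<bar> \<le> (\<integral>x. \<bar>f x * g x\<bar> \<partial>lebesgue_on \<Omega>)"
      by (rule integral_abs_bound)
    also have "\<dots> \<le> (\<integral>x. \<bar>B\<bar> * \<bar>f x\<bar> \<partial>lebesgue_on \<Omega>)"
    proof (rule integral_mono)
      fix x
      have "\<bar>f x\<bar> * \<bar>g x\<bar> \<le> \<bar>f x\<bar> * \<bar>B\<bar>"
        using g(2)[of x] by (intro mult_left_mono) auto
      then show "\<bar>f x * g x\<bar> \<le> \<bar>B\<bar> * \<bar>f x\<bar>"
        by (simp add: abs_mult mult.commute)
    qed (use int[OF f] Lp_integrable[OF assms(1) f assms(2)] in auto)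
    also have "\<dots> = \<bar>B\<bar> * (\<integral>x. \<bar>f x\<bar> \<partial>lebesgue_on \<Omega>)"
      by simp
    also have "\<dots> \<le> \<bar>B\<bar> * ((measure lebesgue \<Omega> + 1) * Lp_norm \<Omega> p f)"
      using integral_abs_le_Lp_norm[OF assms(1) f assms(2)] by (intro mult_left_mono) auto
    finally show ?thesis by (simp add: mult.assoc)
  qed
  show ?thesis
    unfolding Lp_dual_def using int bound
    by (auto simp: distrib_right mult.assoc intro!: exI[of _ "\<bar>B\<bar> * (measure lebesgue \<Omega> + 1)"])
qed

text \<open>Dominated convergence with majorant \<open>\<bar>f x\<bar> powr p\<close>; the pointwise
  hypothesis fits truncations, which equal either \<open>f x\<close> or 0.\<close>

lemma Lp_tendsto_dominated:
  assumes f: "f \<in> Lp \<Omega> p" and g: "\<And>k. g k \<in> borel_measurable (lebesgue_on \<Omega>)"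
    and "0 < p"
    and le: "\<And>k x. \<bar>g k x - f x\<bar> \<le> \<bar>f x\<bar>"
    and lim: "AE x in lebesgue_on \<Omega>. (\<lambda>k. g k x) \<longlonglongrightarrow> f x"
  shows "Lp_tendsto \<Omega> p g f"
proof -
  note [measurable] = Lp_measurable[OF f] g
  have "(\<lambda>k. \<integral>x. \<bar>g k x - f x\<bar> powr p \<partial>lebesgue_on \<Omega>) \<longlonglongrightarrow> (\<integral>x. 0 \<partial>lebesgue_on \<Omega>)"
  proof (rule integral_dominated_convergence[where w = "\<lambda>x. \<bar>f x\<bar> powr p"])
    show "AE x in lebesgue_on \<Omega>. (\<lambda>k. \<bar>g k x - f x\<bar> powr p) \<longlonglongrightarrow> 0"
      using lim
    proof eventually_elim
      case (elim x)
      then have "(\<lambda>k. \<bar>g k x - f x\<bar>) \<longlonglongrightarrow> 0"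
        by (simp add: LIM_zero tendsto_rabs_zero)
      then show ?case
        using \<open>0 < p\<close> by (intro tendsto_zero_powrI[where b = p]) auto
    qed
  qed (use le Lp_integrable_powr[OF f] \<open>0 < p\<close> in \<open>auto intro!: AE_I2 powr_mono2\<close>)
  then show ?thesis
    unfolding Lp_tendsto_def Lp_norm_def
    using \<open>0 < p\<close> by (intro tendsto_zero_powrI[where b = "1/p"]) auto
qed

text \<open>Additivity turns the difference of the values of a functional into its value at the
  difference, which boundedness controls by the norm.\<close>

lemma Lp_tendsto_imp_weak_tendsto:
  assumes "\<And>k. g k \<in> Lp \<Omega> p" and "f \<in> Lp \<Omega> p" and "0 \<le> p" and lim: "Lp_tendsto \<Omega> p g f"
  shows "Lp_weak_tendsto \<Omega> p g f"
  unfolding Lp_weak_tendsto_def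
proof
  fix \<phi> assume \<phi>: "\<phi> \<in> Lp_dual \<Omega> p"
  from \<phi> obtain C where C: "\<And>h. h \<in> Lp \<Omega> p \<Longrightarrow> \<bar>\<phi> h\<bar> \<le> C * Lp_norm \<Omega> p h"
    unfolding Lp_dual_def by blast
  have diff: "(\<lambda>x. g k x - f x) \<in> Lp \<Omega> p" for k
    using assms by (intro Lp_diff)
  have add: "\<phi> (\<lambda>x. a x + b x) = \<phi> a + \<phi> b" if "a \<in> Lp \<Omega> p" "b \<in> Lp \<Omega> p" for a b
    using \<phi> that by (simp add: Lp_dual_def)
  have eq: "\<phi> (g k) - \<phi> f = \<phi> (\<lambda>x. g k x - f x)" for k
    using add[OF diff[of k] assms(2)] by simp
  have "(\<lambda>k. C * Lp_norm \<Omega> p (\<lambda>x. g k x - f x)) \<longlonglongrightarrow> C * 0"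
    using lim unfolding Lp_tendsto_def by (intro tendsto_intros)
  then have "(\<lambda>k. \<phi> (g k) - \<phi> f) \<longlonglongrightarrow> 0"
    using C[OF diff] by (intro Lim_null_comparison[where f = "\<lambda>k. \<phi> (g k) - \<phi> f"]) (auto simp: eq)
  then show "(\<lambda>k. \<phi> (g k)) \<longlonglongrightarrow> \<phi> f"
    by (rule LIM_zero_cancel)
qed

text \<open>Norm convergence says that the p-th powers of the differences tend to 0 in L^1, and an
  L^1 null sequence has a subsequence that vanishes almost everywhere in the limit.\<close>

lemma Lp_tendsto_imp_AE_subseq:
  assumes "\<And>k. g k \<in> Lp \<Omega> p" and "f \<in> Lp \<Omega> p" and "0 < p" and lim: "Lp_tendsto \<Omega> p g f"
  obtains \<sigma> :: "nat \<Rightarrow> nat"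
  where "strict_mono \<sigma>" "AE x in lebesgue_on \<Omega>. (\<lambda>k. g (\<sigma> k) x) \<longlonglongrightarrow> f x"
proof -
  let ?d = "\<lambda>k x. \<bar>g k x - f x\<bar> powr p"
  have int: "integrable (lebesgue_on \<Omega>) (?d k)" for k
    using Lp_diff[OF assms(1)[of k] assms(2)] \<open>0 < p\<close> by (auto intro: Lp_integrable_powr)
  have "(\<lambda>k. Lp_norm \<Omega> p (\<lambda>x. g k x - f x) powr p) \<longlonglongrightarrow> 0"
    using lim \<open>0 < p\<close> unfolding Lp_tendsto_def
    by (intro tendsto_zero_powrI[where b = p]) (auto simp: Lp_norm_nonneg)
  then have "(\<lambda>k. \<integral>x. norm (?d k x) \<partial>lebesgue_on \<Omega>) \<longlonglongrightarrow> 0"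
    using \<open>0 < p\<close> by (simp add: Lp_norm_powr)
  from tendsto_L1_AE_subseq[OF int this] obtain \<sigma> :: "nat \<Rightarrow> nat" where \<sigma>: "strict_mono \<sigma>"
    "AE x in lebesgue_on \<Omega>. (\<lambda>k. ?d (\<sigma> k) x) \<longlonglongrightarrow> 0"
    by auto
  have "AE x in lebesgue_on \<Omega>. (\<lambda>k. g (\<sigma> k) x) \<longlonglongrightarrow> f x"
    using \<sigma>(2)
  proof eventually_elim
    case (elim x)
    then have "(\<lambda>k. ?d (\<sigma> k) x powr (1/p)) \<longlonglongrightarrow> 0"
      using \<open>0 < p\<close> by (intro tendsto_zero_powrI[OF elim tendsto_const]) auto
    then have "(\<lambda>k. \<bar>g (\<sigma> k) x - f x\<bar>) \<longlonglongrightarrow> 0"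
      using \<open>0 < p\<close> by (simp add: powr_powr)
    then show ?case
      by (simp add: tendsto_rabs_zero_iff LIM_zero_iff)
  qed
  with \<sigma>(1) show thesis by (rule that)
qed

section \<open>The Frechet subdifferential\<close>

lemma eventually_Lp_at_0:
  "eventually P (Lp_at_0 \<Omega> p) \<longleftrightarrow>
     (\<exists>d>0. \<forall>h\<in>Lp \<Omega> p. 0 < Lp_norm \<Omega> p h \<longrightarrow> Lp_norm \<Omega> p h < d \<longrightarrow> P h)"
proof
  assume "eventually P (Lp_at_0 \<Omega> p)"
  then obtain Q where Q: "eventually Q (at_right (0::real))"
    "\<And>h. Q (Lp_norm \<Omega> p h) \<Longrightarrow> h \<in> Lp \<Omega> p \<Longrightarrow> P h"
    unfolding Lp_at_0_def eventually_inf_principal eventually_filtercomap by blast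
  then show "\<exists>d>0. \<forall>h\<in>Lp \<Omega> p. 0 < Lp_norm \<Omega> p h \<longrightarrow> Lp_norm \<Omega> p h < d \<longrightarrow> P h"
    by (auto simp: eventually_at_right_field)
next
  assume "\<exists>d>0. \<forall>h\<in>Lp \<Omega> p. 0 < Lp_norm \<Omega> p h \<longrightarrow> Lp_norm \<Omega> p h < d \<longrightarrow> P h"
  then obtain d where d: "0 < d"
    "\<And>h. h \<in> Lp \<Omega> p \<Longrightarrow> 0 < Lp_norm \<Omega> p h \<Longrightarrow> Lp_norm \<Omega> p h < d \<Longrightarrow> P h"
    by blast
  have "eventually (\<lambda>y. 0 < y \<and> y < d) (at_right (0::real))"
    using d(1) by (auto simp: eventually_at_right_field)
  with d(2) show "eventually P (Lp_at_0 \<Omega> p)"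
    unfolding Lp_at_0_def eventually_inf_principal eventually_filtercomap by blast
qed

lemma integrable_abs0:
  assumes "\<Omega> \<in> lmeasurable" "f \<in> borel_measurable (lebesgue_on \<Omega>)"
  shows "integrable (lebesgue_on \<Omega>) (\<lambda>x. abs0 (f x))"
proof -
  interpret finite_measure "lebesgue_on \<Omega>"
    by (rule finite_measure_lebesgue_on) fact
  note [measurable] = assms(2)
  show ?thesis
    unfolding abs0_def by (intro integrable_const_bound[where B = 1]) (auto intro!: AE_I2)
qed

text \<open>Test with \<open>h = t sgn \<eta>\<close> on \<open>{\<bar>u\<bar> > \<delta>}\<close> for \<open>t \<le> \<delta>\<close>: such \<open>h\<close> leave the support of \<open>u\<close>
  unchanged, and the difference quotient does not depend on \<open>t\<close>.\<close>

lemma frechet_subdiff_q0_AE_zero: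
  assumes \<Omega>: "\<Omega> \<in> lmeasurable" and "1 \<le> s" "1 \<le> r" and u: "u \<in> Lp \<Omega> s"
    and \<eta>: "\<eta> \<in> frechet_subdiff_q0 \<Omega> s r u"
  shows "AE x in lebesgue_on \<Omega>. u x \<noteq> 0 \<longrightarrow> \<eta> x = 0"
proof -
  have \<eta>r: "\<eta> \<in> Lp \<Omega> r" using \<eta> by (simp add: frechet_subdiff_q0_def)
  note [measurable] = Lp_measurable[OF u] Lp_measurable[OF \<eta>r]
  have step: "AE x in lebesgue_on \<Omega>. \<delta> < \<bar>u x\<bar> \<longrightarrow> \<eta> x = 0" if \<delta>: "0 < \<delta>" for \<delta> :: real
  proof (rule ccontr)
    assume not: "\<not> (AE x in lebesgue_on \<Omega>. \<delta> < \<bar>u x\<bar> \<longrightarrow> \<eta> x = 0)"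
    \<comment> \<open>The pairing \<open>c\<close> is the integral of
      \<open>\<bar>\<eta>\<bar>\<close> over {\<bar>u\<bar> > \<delta>}; failure of the claim makes
      both \<open>c\<close> and the norm \<open>n\<close> positive.\<close>
    define v where "v = (\<lambda>x. if \<delta> < \<bar>u x\<bar> then sgn (\<eta> x) else 0)"
    define c where "c = (\<integral>x. \<eta> x * v x \<partial>lebesgue_on \<Omega>)"
    define n where "n = Lp_norm \<Omega> s v"
    have v_meas [measurable]: "v \<in> borel_measurable (lebesgue_on \<Omega>)"
      unfolding v_def by measurable
    have v1: "\<bar>v x\<bar> \<le> 1" for x
      by (simp add: v_def sgn_if)
    have v: "v \<in> Lp \<Omega> s"
      using \<open>1 \<le> s\<close> v1 by (intro Lp_bounded[OF \<Omega> v_meas]) auto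
    have int: "integrable (lebesgue_on \<Omega>) (\<lambda>x. \<eta> x * v x)"
      by (intro Lp_integrable_mult_bounded[OF \<Omega> \<eta>r \<open>1 \<le> r\<close> v_meas v1])
    have v0: "v x = 0 \<longleftrightarrow> (\<delta> < \<bar>u x\<bar> \<longrightarrow> \<eta> x = 0)" for x
      by (simp add: v_def sgn_if)
    have \<eta>v: "\<eta> x * v x = 0 \<longleftrightarrow> v x = 0" "0 \<le> \<eta> x * v x" for x
      by (auto simp: v_def sgn_if)
    have "n \<noteq> 0"
      using not \<open>1 \<le> s\<close> by (simp add: n_def Lp_norm_eq_0_iff[OF v] v0)
    then have n: "0 < n"
      using Lp_norm_nonneg[of \<Omega> s v] by (simp add: n_def)
    have "c \<noteq> 0"
      using not integral_nonneg_eq_0_iff_AE[OF int] \<eta>v by (simp add: c_def v0)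
    then have c: "0 < c"
      using \<eta>v(2) by (simp add: c_def order_less_le)
    have "0 \<le> Liminf (Lp_at_0 \<Omega> s)
       (\<lambda>h. ereal ((q0 \<Omega> (\<lambda>x. u x + h x) - q0 \<Omega> u - (\<integral>x. \<eta> x * h x \<partial>lebesgue_on \<Omega>))
                     / Lp_norm \<Omega> s h))"
      using \<eta> by (simp add: frechet_subdiff_q0_def)
    \<comment> \<open>The value \<open>- c / n\<close> is exactly the quotient at
      \<open>t * v\<close> for every \<open>0 < t \<le> \<delta>\<close>, so a strict lower bound by
      it is refuted by one small \<open>t\<close>.\<close>
    moreover have "ereal (- c / n) < 0"
      using c n by simp
    ultimately have "eventually (\<lambda>h. ereal (- c / n) < ereal ((q0 \<Omega> (\<lambda>x. u x + h x) - q0 \<Omega> u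
       - (\<integral>x. \<eta> x * h x \<partial>lebesgue_on \<Omega>)) / Lp_norm \<Omega> s h)) (Lp_at_0 \<Omega> s)"
      unfolding le_Liminf_iff by blast
    then obtain d where d: "0 < d" "\<And>h. h \<in> Lp \<Omega> s \<Longrightarrow> 0 < Lp_norm \<Omega> s h \<Longrightarrow> Lp_norm \<Omega> s h < d \<Longrightarrow>
       - c / n < (q0 \<Omega> (\<lambda>x. u x + h x) - q0 \<Omega> u - (\<integral>x. \<eta> x * h x \<partial>lebesgue_on \<Omega>)) / Lp_norm \<Omega> s h"
      unfolding eventually_Lp_at_0 by auto
    \<comment> \<open>The bound \<open>\<delta>\<close> preserves the support of \<open>u\<close>;
      the factor 2 puts the norm \<open>t * n\<close> strictly below \<open>d\<close>.\<close>
    define t where "t = min \<delta> (d / (2 * n))"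
    have t: "0 < t" "t \<le> \<delta>" using \<delta> d(1) n by (auto simp: t_def)
    have "t * n \<le> d / (2 * n) * n" using n by (intro mult_right_mono) (auto simp: t_def)
    then have tn: "t * n < d" using n d(1) by simp
    have norm: "Lp_norm \<Omega> s (\<lambda>x. t * v x) = t * n"
      using t \<open>1 \<le> s\<close> by (simp add: Lp_norm_cmult n_def)
    have supp: "abs0 (u x + t * v x) = abs0 (u x)" for x
    proof (cases "\<delta> < \<bar>u x\<bar>")
      case True
      have "\<bar>t * v x\<bar> \<le> t" using t(1) v1[of x] by (simp add: abs_mult mult_left_le)
      then have "u x + t * v x \<noteq> 0" "u x \<noteq> 0" using True t(2) \<delta> by auto
      then show ?thesis by (simp add: abs0_def)
    qed (simp add: v_def)
    have "(\<integral>x. \<eta> x * (t * v x) \<partial>lebesgue_on \<Omega>) = t * c"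
      by (simp add: c_def mult.left_commute)
    then have "- c / n < (- (t * c)) / (t * n)"
      using d(2)[of "\<lambda>x. t * v x"] Lp_cmult[OF v, of t] t n tn
      by (simp add: norm q0_def supp)
    then show False using t by simp
  qed
  \<comment> \<open>Countably many thresholds exhaust {u \<noteq> 0}, so the exceptional null sets
    can be united.\<close>
  have "AE x in lebesgue_on \<Omega>. \<forall>k. inverse (real (Suc k)) < \<bar>u x\<bar> \<longrightarrow> \<eta> x = 0"
    unfolding AE_all_countable by (intro allI step) simp
  then show ?thesis
    by eventually_elim (metis reals_Archimedean zero_less_abs_iff)
qed

text \<open>If \<open>u\<close> is bounded away from zero on its support, the difference
  \<open>abs0 (u + h) - abs0 u - \<eta> h\<close> is bounded below pointwise by a multiple of \<open>-\<bar>h\<bar> powr s\<close>,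
  whose integral is \<open>o(\<parallel>h\<parallel>)\<close> because \<open>s > 1\<close>.\<close>

lemma bounded_in_frechet_subdiff_q0:
  assumes \<Omega>: "\<Omega> \<in> lmeasurable" and "1 < s" "1 < r" and u: "u \<in> Lp \<Omega> s" and \<eta>: "\<eta> \<in> Lp \<Omega> r"
    and "0 < \<delta>" and away: "\<And>x. u x \<noteq> 0 \<Longrightarrow> \<delta> \<le> \<bar>u x\<bar>"
    and M: "\<And>x. \<bar>\<eta> x\<bar> \<le> M" and supp: "\<And>x. u x \<noteq> 0 \<Longrightarrow> \<eta> x = 0"
  shows "\<eta> \<in> frechet_subdiff_q0 \<Omega> s r u"
proof -
  note [measurable] = Lp_measurable[OF u] Lp_measurable[OF \<eta>]
  \<comment> \<open>The first summand serves the points with \<open>u x = 0\<close>, the second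
    those where \<open>h\<close> cancels \<open>u x\<close>.\<close>
  define K where "K = M powr s + (1 / \<delta>) powr s"
  have "0 < K"
    unfolding K_def using \<open>0 < \<delta>\<close> by (intro add_nonneg_pos) auto
  have M0: "0 \<le> M" using M[of undefined] by linarith
  have point: "- K * \<bar>h\<bar> powr s \<le> abs0 (u x + h) - abs0 (u x) - \<eta> x * h" for x h
  proof (cases "u x = 0")
    case True
    have "\<eta> x * h \<le> \<bar>\<eta> x\<bar> * \<bar>h\<bar>" by (metis abs_ge_self abs_mult)
    also have "\<dots> \<le> M * \<bar>h\<bar>" using M[of x] by (intro mult_right_mono) auto
    \<comment> \<open>The 1 is repaid by the jump of \<open>abs0\<close> when
      \<open>h \<noteq> 0\<close>; for \<open>h = 0\<close> both sides of the claim vanish.\<close>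
    also have "\<dots> \<le> 1 + (M * \<bar>h\<bar>) powr s"
      using M0 \<open>1 < s\<close> by (intro le_one_plus_powr) auto
    also have "\<dots> = 1 + M powr s * \<bar>h\<bar> powr s"
      by (simp add: powr_mult)
    also have "\<dots> \<le> 1 + K * \<bar>h\<bar> powr s"
      unfolding K_def by (intro add_left_mono mult_right_mono) auto
    finally show ?thesis using True by (auto simp: abs0_def)
  next
    case False
    show ?thesis
    proof (cases "u x + h = 0")
      case True
      \<comment> \<open>Cancellation forces
        \<open>\<bar>h\<bar> = \<bar>u x\<bar> \<ge> \<delta>\<close>, so the power term covers the
        unit that \<open>abs0\<close> loses.\<close>
      have "1 \<le> (1 / \<delta> * \<bar>h\<bar>) powr s"
        using True away[OF False] \<open>0 < \<delta>\<close> \<open>1 < s\<close>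
        by (intro ge_one_powr_ge_zero) (auto simp: field_simps abs_if split: if_splits)
      also have "\<dots> = (1 / \<delta>) powr s * \<bar>h\<bar> powr s"
        by (simp only: powr_mult)
      also have "\<dots> \<le> K * \<bar>h\<bar> powr s"
        unfolding K_def by (intro mult_right_mono) auto
      finally show ?thesis using True False supp[OF False] by (simp add: abs0_def)
    next
      case nz: False
      have "0 \<le> K * \<bar>h\<bar> powr s" using \<open>0 < K\<close> by simp
      then show ?thesis using False nz supp[OF False] by (simp add: abs0_def)
    qed
  qed
  have bound: "- K * Lp_norm \<Omega> s h powr s
      \<le> q0 \<Omega> (\<lambda>x. u x + h x) - q0 \<Omega> u - (\<integral>x. \<eta> x * h x \<partial>lebesgue_on \<Omega>)"
    if h: "h \<in> Lp \<Omega> s" for h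
  proof -
    note [measurable] = Lp_measurable[OF h]
    have int: "integrable (lebesgue_on \<Omega>) (\<lambda>x. \<eta> x * h x)"
      using Lp_integrable_mult_bounded[OF \<Omega> h _ Lp_measurable[OF \<eta>] M] \<open>1 < s\<close> by (simp add: mult.commute)
    have int0: "integrable (lebesgue_on \<Omega>) (\<lambda>x. abs0 (u x + h x))"
      "integrable (lebesgue_on \<Omega>) (\<lambda>x. abs0 (u x))"
      by (intro integrable_abs0[OF \<Omega>]; measurable)+
    have "- K * Lp_norm \<Omega> s h powr s = (\<integral>x. - K * \<bar>h x\<bar> powr s \<partial>lebesgue_on \<Omega>)"
      using \<open>1 < s\<close> by (simp add: Lp_norm_powr)
    also have "\<dots> \<le> (\<integral>x. abs0 (u x + h x) - abs0 (u x) - \<eta> x * h x \<partial>lebesgue_on \<Omega>)"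
      using Lp_integrable_powr[OF h] int int0 point by (intro integral_mono) auto
    also have "\<dots> = q0 \<Omega> (\<lambda>x. u x + h x) - q0 \<Omega> u - (\<integral>x. \<eta> x * h x \<partial>lebesgue_on \<Omega>)"
      using int int0 by (simp add: q0_def)
    finally show ?thesis .
  qed
  have "eventually (\<lambda>h. y < ereal ((q0 \<Omega> (\<lambda>x. u x + h x) - q0 \<Omega> u - (\<integral>x. \<eta> x * h x \<partial>lebesgue_on \<Omega>))
                     / Lp_norm \<Omega> s h)) (Lp_at_0 \<Omega> s)" if "y < 0" for y
  proof -
    \<comment> \<open>The level \<open>y\<close> may be minus infinity; a finite negative level
      above it is used instead.\<close>
    obtain e where e: "y \<le> ereal (- e)" "0 < e"
    proof (cases y)
      case (real a)
      with \<open>y < 0\<close> show thesis by (intro that[of "- a"]) auto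
    next
      case MInf
      then show thesis by (intro that[of 1]) auto
    qed (use \<open>y < 0\<close> in simp)
    \<comment> \<open>This is the integrated lower bound divided by the norm \<open>N\<close>, up to
      sign; it tends to 0 since \<open>s - 1\<close> is positive.\<close>
    have "((\<lambda>N. K * N powr (s - 1)) \<longlongrightarrow> K * 0) (at_right (0::real))"
      using \<open>1 < s\<close>
      by (intro tendsto_intros tendsto_zero_powrI[where b = "s - 1"])
         (auto simp: eventually_at_right_field intro: tendsto_ident_at gt_ex)
    then have "eventually (\<lambda>N. K * N powr (s - 1) < e) (at_right (0::real))"
      using e(2) by (simp add: order_tendsto_iff)
    then obtain d where d: "0 < d" "\<And>N. 0 < N \<Longrightarrow> N < d \<Longrightarrow> K * N powr (s - 1) < e"
      by (auto simp: eventually_at_right_field)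
    show ?thesis
      unfolding eventually_Lp_at_0
    proof (intro exI[of _ d] conjI ballI impI)
      fix h assume h: "h \<in> Lp \<Omega> s" "0 < Lp_norm \<Omega> s h" "Lp_norm \<Omega> s h < d"
      let ?N = "Lp_norm \<Omega> s h"
      have "?N powr s = ?N powr (s - 1) * ?N"
        using h(2) by (simp add: powr_diff)
      then have "- (K * ?N powr (s - 1)) * ?N
          \<le> q0 \<Omega> (\<lambda>x. u x + h x) - q0 \<Omega> u - (\<integral>x. \<eta> x * h x \<partial>lebesgue_on \<Omega>)"
        using bound[OF h(1)] by (simp add: mult.assoc)
      then have "- (K * ?N powr (s - 1))
          \<le> (q0 \<Omega> (\<lambda>x. u x + h x) - q0 \<Omega> u - (\<integral>x. \<eta> x * h x \<partial>lebesgue_on \<Omega>)) / ?N"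
        using h(2) by (simp add: pos_le_divide_eq)
      then have "- e < (q0 \<Omega> (\<lambda>x. u x + h x) - q0 \<Omega> u - (\<integral>x. \<eta> x * h x \<partial>lebesgue_on \<Omega>)) / ?N"
        using d(2)[OF h(2,3)] by linarith
      then show "y < ereal ((q0 \<Omega> (\<lambda>x. u x + h x) - q0 \<Omega> u
          - (\<integral>x. \<eta> x * h x \<partial>lebesgue_on \<Omega>)) / ?N)"
        using e(1) by (meson ereal_less_eq(3) le_less_trans less_ereal.simps(1))
    qed (rule d(1))
  qed
  then show ?thesis
    using \<eta> by (simp add: frechet_subdiff_q0_def le_Liminf_iff)
qed

section \<open>The limiting subdifferential\<close>

text \<open>Along a subsequence \<open>U k \<rightarrow> u\<close> almost everywhere, so almost every point of \<open>{u \<noteq> 0}\<close> lies in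
  one of the sets \<open>E N\<close> on which \<open>U k \<noteq> 0\<close>, hence \<open>H k = 0\<close>, for all \<open>k \<ge> N\<close>. Testing weak
  convergence on each \<open>E N\<close> separately avoids any bound on \<open>\<parallel>H k\<parallel>\<close>.\<close>

lemma limiting_subdiff_q0_AE_zero:
  assumes \<Omega>: "\<Omega> \<in> lmeasurable" and "1 \<le> s" "1 \<le> r" and u: "u \<in> Lp \<Omega> s"
    and \<eta>: "\<eta> \<in> limiting_subdiff_q0 \<Omega> s r u"
  shows "AE x in lebesgue_on \<Omega>. u x \<noteq> 0 \<longrightarrow> \<eta> x = 0"
proof -
  from \<eta> obtain U H where \<eta>r: "\<eta> \<in> Lp \<Omega> r" and U: "\<And>k. U k \<in> Lp \<Omega> s"
    and lim: "Lp_tendsto \<Omega> s U u" and weak: "Lp_weak_tendsto \<Omega> r H \<eta>"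
    and H: "\<And>k. H k \<in> frechet_subdiff_q0 \<Omega> s r (U k)"
    unfolding limiting_subdiff_q0_def by blast
  have "0 < s" using \<open>1 \<le> s\<close> by simp
  from Lp_tendsto_imp_AE_subseq[OF U u this lim] obtain \<sigma> :: "nat \<Rightarrow> nat"
    where \<sigma>: "strict_mono \<sigma>" and ae: "AE x in lebesgue_on \<Omega>. (\<lambda>k. U (\<sigma> k) x) \<longlonglongrightarrow> u x" .
  note [measurable] = Lp_measurable[OF \<eta>r] Lp_measurable[OF u] Lp_measurable[OF U]
  define E where "E = (\<lambda>N x. \<forall>k\<ge>N. U (\<sigma> k) x \<noteq> 0)"
  have E_meas [measurable]: "Measurable.pred (lebesgue_on \<Omega>) (E N)" for N
    unfolding E_def by measurable
  have zero: "AE x in lebesgue_on \<Omega>. E N x \<longrightarrow> \<eta> x = 0" for N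
  proof -
    \<comment> \<open>With this sign the pairing with \<open>\<eta>\<close> is the integral of
      \<open>\<bar>\<eta>\<bar>\<close> over \<open>E N\<close>, so a zero pairing forces
      \<open>\<eta>\<close> to vanish there.\<close>
    define v where "v = (\<lambda>x. if E N x then sgn (\<eta> x) else 0)"
    have v_meas [measurable]: "v \<in> borel_measurable (lebesgue_on \<Omega>)"
      unfolding v_def by measurable
    have v1: "\<bar>v x\<bar> \<le> 1" for x
      by (simp add: v_def sgn_if)
    have "(\<lambda>f. \<integral>x. f x * v x \<partial>lebesgue_on \<Omega>) \<in> Lp_dual \<Omega> r"
      by (rule integral_mult_bounded_in_Lp_dual[OF \<Omega> \<open>1 \<le> r\<close> v_meas v1])
    with weak have "(\<lambda>k. \<integral>x. H k x * v x \<partial>lebesgue_on \<Omega>) \<longlonglongrightarrow> (\<integral>x. \<eta> x * v x \<partial>lebesgue_on \<Omega>)"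
      unfolding Lp_weak_tendsto_def by (rule bspec)
    from LIMSEQ_subseq_LIMSEQ[OF this \<sigma>]
    have 1: "(\<lambda>k. \<integral>x. H (\<sigma> k) x * v x \<partial>lebesgue_on \<Omega>) \<longlonglongrightarrow> (\<integral>x. \<eta> x * v x \<partial>lebesgue_on \<Omega>)"
      by (simp add: o_def)
    have "(\<integral>x. H (\<sigma> k) x * v x \<partial>lebesgue_on \<Omega>) = 0" if "N \<le> k" for k
    proof (rule integral_eq_zero_AE)
      show "AE x in lebesgue_on \<Omega>. H (\<sigma> k) x * v x = 0"
        using frechet_subdiff_q0_AE_zero[OF \<Omega> \<open>1 \<le> s\<close> \<open>1 \<le> r\<close> U H, of "\<sigma> k"]
        by eventually_elim (use that in \<open>auto simp: v_def E_def\<close>)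
    qed
    then have "(\<lambda>k. \<integral>x. H (\<sigma> k) x * v x \<partial>lebesgue_on \<Omega>) \<longlonglongrightarrow> 0"
      by (intro tendsto_eventually) (auto simp: eventually_sequentially)
    with 1 have "(\<integral>x. \<eta> x * v x \<partial>lebesgue_on \<Omega>) = 0"
      by (rule LIMSEQ_unique)
    moreover have "0 \<le> \<eta> x * v x" for x
      by (auto simp: v_def sgn_if)
    ultimately have "AE x in lebesgue_on \<Omega>. \<eta> x * v x = 0"
      using Lp_integrable_mult_bounded[OF \<Omega> \<eta>r \<open>1 \<le> r\<close> v_meas v1]
      by (simp add: integral_nonneg_eq_0_iff_AE)
    then show ?thesis
      by eventually_elim (auto simp: v_def sgn_if split: if_splits)
  qed
  then have "AE x in lebesgue_on \<Omega>. \<forall>N. E N x \<longrightarrow> \<eta> x = 0"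
    by (subst AE_all_countable) blast
  with ae show ?thesis
  proof eventually_elim
    case (elim x)
    show ?case
    proof
      assume "u x \<noteq> 0"
      with elim(1) have "eventually (\<lambda>k. U (\<sigma> k) x \<noteq> 0) sequentially"
        by (rule tendsto_imp_eventually_ne)
      then show "\<eta> x = 0"
        using elim(2) by (auto simp: E_def eventually_sequentially)
    qed
  qed
qed

text \<open>Truncation brings each pair \<open>U k\<close>, \<open>H k\<close> within reach of
  \<open>bounded_in_frechet_subdiff_q0\<close>. At almost every point the truncations are eventually
  inactive, so dominated convergence yields norm convergence of both sequences, hence weak
  convergence of \<open>H\<close>, and convergence of \<open>q0\<close>.\<close>

lemma AE_zero_in_limiting_subdiff_q0:
  assumes \<Omega>: "\<Omega> \<in> lmeasurable" and "1 < s" "1 < r" and u: "u \<in> Lp \<Omega> s" and \<eta>: "\<eta> \<in> Lp \<Omega> r"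
    and ae: "AE x in lebesgue_on \<Omega>. u x \<noteq> 0 \<longrightarrow> \<eta> x = 0"
  shows "\<eta> \<in> limiting_subdiff_q0 \<Omega> s r u"
proof -
  interpret finite_measure "lebesgue_on \<Omega>"
    by (rule finite_measure_lebesgue_on) fact
  note [measurable] = Lp_measurable[OF u] Lp_measurable[OF \<eta>]
  define U where "U = (\<lambda>k x. if inverse (real (Suc k)) \<le> \<bar>u x\<bar> then u x else 0)"
  \<comment> \<open>Since \<open>\<eta>\<close> vanishes on {u \<noteq> 0} only almost everywhere,
    the condition \<open>u x = 0\<close> enforces this at every point; a nonzero
    \<open>U k x\<close> implies a nonzero \<open>u x\<close>, hence
    \<open>H k x = 0\<close>.\<close>
  define H where "H = (\<lambda>k x. if \<bar>\<eta> x\<bar> \<le> real k \<and> u x = 0 then \<eta> x else 0)"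
  have U_meas [measurable]: "U k \<in> borel_measurable (lebesgue_on \<Omega>)" for k
    unfolding U_def by measurable
  have H_meas [measurable]: "H k \<in> borel_measurable (lebesgue_on \<Omega>)" for k
    unfolding H_def by measurable
  have U: "U k \<in> Lp \<Omega> s" for k
    using \<open>1 < s\<close> by (intro Lp_dominated[OF u U_meas]) (auto simp: U_def)
  have H: "H k \<in> Lp \<Omega> r" for k
    using \<open>1 < r\<close> by (intro Lp_dominated[OF \<eta> H_meas]) (auto simp: H_def)
  have U_ev: "eventually (\<lambda>k. U k x = u x) sequentially" for x
  proof (cases "u x = 0")
    case False
    then have "eventually (\<lambda>k. inverse (real (Suc k)) < \<bar>u x\<bar>) sequentially"
      using LIMSEQ_inverse_real_of_nat by (intro order_tendstoD) auto
    then show ?thesis by eventually_elim (simp add: U_def)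
  qed (simp add: U_def)
  have H_ev: "AE x in lebesgue_on \<Omega>. eventually (\<lambda>k. H k x = \<eta> x) sequentially"
    using ae
  proof eventually_elim
    case (elim x)
    have "eventually (\<lambda>k. \<bar>\<eta> x\<bar> \<le> real k) sequentially"
      using filterlim_real_sequentially by (simp add: filterlim_at_top)
    then show ?case by eventually_elim (use elim in \<open>auto simp: H_def\<close>)
  qed
  have U_lim: "Lp_tendsto \<Omega> s U u"
    using \<open>1 < s\<close> U_ev
    by (intro Lp_tendsto_dominated[OF u U_meas]) (auto simp: U_def intro!: AE_I2 tendsto_eventually)
  have "AE x in lebesgue_on \<Omega>. (\<lambda>k. H k x) \<longlonglongrightarrow> \<eta> x"
    using H_ev by eventually_elim (rule tendsto_eventually)
  then have "Lp_tendsto \<Omega> r H \<eta>"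
    using \<open>1 < r\<close> by (intro Lp_tendsto_dominated[OF \<eta> H_meas]) (auto simp: H_def)
  then have H_lim: "Lp_weak_tendsto \<Omega> r H \<eta>"
    using \<open>1 < r\<close> by (intro Lp_tendsto_imp_weak_tendsto[OF H \<eta>]) auto
  have q_lim: "(\<lambda>k. q0 \<Omega> (U k)) \<longlonglongrightarrow> q0 \<Omega> u"
    unfolding q0_def
  proof (rule integral_dominated_convergence[where w = "\<lambda>x. 1"])
    show "AE x in lebesgue_on \<Omega>. (\<lambda>k. abs0 (U k x)) \<longlonglongrightarrow> abs0 (u x)"
    proof (rule AE_I2)
      fix x
      show "(\<lambda>k. abs0 (U k x)) \<longlonglongrightarrow> abs0 (u x)"
        using U_ev[of x] by (intro tendsto_eventually) (auto elim: eventually_mono)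
    qed
  qed (auto simp: abs0_def[abs_def])
  have "H k \<in> frechet_subdiff_q0 \<Omega> s r (U k)" for k
    using \<open>1 < s\<close> \<open>1 < r\<close>
    by (intro bounded_in_frechet_subdiff_q0[OF \<Omega> _ _ U H, where \<delta> = "inverse (real (Suc k))" and M = "real k"])
       (auto simp: U_def H_def split: if_splits)
  with \<eta> U H U_lim q_lim H_lim show ?thesis
    unfolding limiting_subdiff_q0_def by blast
qed

text \<open>The set difference consists of the points of \<open>\<Omega>\<close> where both
  functions are nonzero; it is measurable, so being null is an almost everywhere statement.\<close>

lemma ae_subset_iff_AE:
  fixes \<eta> u :: "'a::euclidean_space \<Rightarrow> real"
  assumes "\<Omega> \<in> sets lebesgue"
    and [measurable]: "\<eta> \<in> borel_measurable (lebesgue_on \<Omega>)" "u \<in> borel_measurable (lebesgue_on \<Omega>)"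
  shows "ae_subset {x \<in> \<Omega>. \<eta> x \<noteq> 0} {x \<in> \<Omega>. u x = 0} \<longleftrightarrow>
         (AE x in lebesgue_on \<Omega>. u x \<noteq> 0 \<longrightarrow> \<eta> x = 0)"
proof -
  have "{x \<in> space (lebesgue_on \<Omega>). \<eta> x \<noteq> 0 \<and> u x \<noteq> 0} \<in> sets (lebesgue_on \<Omega>)"
    by measurable
  then have "{x \<in> \<Omega>. \<eta> x \<noteq> 0 \<and> u x \<noteq> 0} \<in> sets lebesgue"
    using assms(1) by (simp add: sets_restrict_space_iff)
  then have "{x \<in> \<Omega>. \<eta> x \<noteq> 0 \<and> u x \<noteq> 0} \<in> null_sets lebesgue \<longleftrightarrow>
      (AE x in lebesgue. x \<notin> {x \<in> \<Omega>. \<eta> x \<noteq> 0 \<and> u x \<noteq> 0})"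
    by (rule AE_iff_null_sets)
  also have "\<dots> \<longleftrightarrow> (AE x in lebesgue_on \<Omega>. u x \<noteq> 0 \<longrightarrow> \<eta> x = 0)"
    using assms(1) by (simp add: AE_restrict_space_iff) (rule AE_cong, blast)
  also have "{x \<in> \<Omega>. \<eta> x \<noteq> 0 \<and> u x \<noteq> 0} = {x \<in> \<Omega>. \<eta> x \<noteq> 0} - {x \<in> \<Omega>. u x = 0}"
    by blast
  finally show ?thesis by (simp only: ae_subset_def)
qed

theorem theorem3p7:
  fixes \<Omega> :: "'a::euclidean_space set" and s r :: real and u :: "'a \<Rightarrow> real"
  assumes "\<Omega> \<in> sets lebesgue" and "0 < emeasure lebesgue \<Omega>" and "emeasure lebesgue \<Omega> < \<infinity>"
    and "1 < s" and "1 < r" and "1 / s + 1 / r = 1"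
    and "u \<in> Lp \<Omega> s"
  shows "limiting_subdiff_q0 \<Omega> s r u =
         {\<eta> \<in> Lp \<Omega> r. ae_subset {x \<in> \<Omega>. \<eta> x \<noteq> 0} {x \<in> \<Omega>. u x = 0}}"
proof -
  have \<Omega>: "\<Omega> \<in> lmeasurable"
    using assms(1,3) by (simp add: fmeasurable_def)
  have iff: "ae_subset {x \<in> \<Omega>. \<eta> x \<noteq> 0} {x \<in> \<Omega>. u x = 0} \<longleftrightarrow>
      (AE x in lebesgue_on \<Omega>. u x \<noteq> 0 \<longrightarrow> \<eta> x = 0)" if "\<eta> \<in> Lp \<Omega> r" for \<eta>
    using Lp_measurable[OF that] Lp_measurable[OF assms(7)] by (rule ae_subset_iff_AE[OF assms(1)])
  have "\<eta> \<in> Lp \<Omega> r" if "\<eta> \<in> limiting_subdiff_q0 \<Omega> s r u" for \<eta>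
    using that by (simp add: limiting_subdiff_q0_def)
  moreover have "AE x in lebesgue_on \<Omega>. u x \<noteq> 0 \<longrightarrow> \<eta> x = 0"
    if "\<eta> \<in> limiting_subdiff_q0 \<Omega> s r u" for \<eta>
    using limiting_subdiff_q0_AE_zero[OF \<Omega> _ _ assms(7) that] assms(4,5) by simp
  moreover note AE_zero_in_limiting_subdiff_q0[OF \<Omega> assms(4,5,7)]
  ultimately show ?thesis
    using iff by blast
qed

end
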